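(* Without a uniform bound on height the well-quasi-order property fails: there exist a finite set $\mathsf{PROP}$ of propositional symbols and classes of finite pointed tree-shaped Kripke models over $\mathsf{PROP}$ (of unbounded height) such that the embedding relation on one such class is not a well-quasi-order, the injective homomorphism relation on one such class is not a well-quasi-order, and the homomorphism relation on one such class is not a well-quasi-order.
   Context: A Kripke model is $\mathfrak{M}=(W,R,V)$ with $W$ non-empty finite, $R\subseteq W\times W$, $V:\mathsf{PROP}\to 2^W$; a pointed model is $(\mathfrak{M},w)$. It is tree-shaped if every $v\in W$ has a unique directed $R$-path from $w$; its height is the length of the longest directed path from $w$. For $\mathfrak{N}=(W',R',V')$ and $f:W\to W'$ with $f(w)=v$: $f$ is a homomorphism if $uRz$ implies $f(u)R'f(z)$ and $u\in V(p)$ implies $f(u)\in V'(p)$; an injective homomorphism if moreover injective; an embedding if injective and $uRz$ iff $f(u)R'f(z)$ and $u\in V(p)$ iff $f(u)\in V'(p)$. Each notion yields a relation $(\mathfrak{M},w)\preceq(\mathfrak{N},v)$ iff such a map exists. A well-quasi-order is a reflexive, transitive relation such that every infinite sequence $a_1,a_2,\dots$ contains $i<j$ with $a_i\preceq a_j$. *)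

theory Defs
  imports "HOL-Library.FuncSet"
begin

record ('w, 'p) kripke =
  worlds :: "'w set"
  acc :: "('w \<times> 'w) set"
  val :: "'p \<Rightarrow> 'w set"

definition kripke_model :: "'p set \<Rightarrow> ('w, 'p) kripke \<Rightarrow> bool" where
  "kripke_model Props M \<longleftrightarrow>
     worlds M \<noteq> {} \<and> finite (worlds M) \<and>
     acc M \<subseteq> worlds M \<times> worlds M \<and>
     val M \<in> Props \<rightarrow>\<^sub>E Pow (worlds M)"

type_synonym ('w, 'p) pointed = "('w, 'p) kripke \<times> 'w"

definition pointed_model :: "'p set \<Rightarrow> ('w, 'p) pointed \<Rightarrow> bool" where
  "pointed_model Props = (\<lambda>(M, w). kripke_model Props M \<and> w \<in> worlds M)"

text \<open>
  A directed path is given by the non-empty list of the worlds it visits, in order. Worlds may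
  repeat, so that unique existence of paths from the root also excludes cycles. The length of a
  path is its number of edges.
\<close>

definition dpath_from :: "('w, 'p) kripke \<Rightarrow> 'w \<Rightarrow> 'w list \<Rightarrow> bool" where
  "dpath_from M w xs \<longleftrightarrow>
     xs \<noteq> [] \<and> hd xs = w \<and> set xs \<subseteq> worlds M \<and>
     successively (\<lambda>x y. (x, y) \<in> acc M) xs"

definition dpath_length :: "'w list \<Rightarrow> nat" where
  "dpath_length xs = length xs - 1"

definition tree_shaped :: "('w, 'p) pointed \<Rightarrow> bool" where
  "tree_shaped = (\<lambda>(M, w). \<forall>v\<in>worlds M. \<exists>!xs. dpath_from M w xs \<and> last xs = v)"

text \<open>
  The maximum is over a finite non-empty set whenever the model is finite and tree-shaped.
\<close>

definition height :: "('w, 'p) pointed \<Rightarrow> nat" where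
  "height = (\<lambda>(M, w). Max {dpath_length xs | xs. dpath_from M w xs})"

definition unbounded_height :: "('w, 'p) pointed set \<Rightarrow> bool" where
  "unbounded_height C \<longleftrightarrow> (\<forall>n. \<exists>P\<in>C. height P > n)"

definition is_hom ::
  "'p set \<Rightarrow> ('w, 'p) pointed \<Rightarrow> ('v, 'p) pointed \<Rightarrow> ('w \<Rightarrow> 'v) \<Rightarrow> bool" where
  "is_hom Props = (\<lambda>(M, w) (N, v) f.
     f \<in> worlds M \<rightarrow> worlds N \<and> f w = v \<and>
     (\<forall>u\<in>worlds M. \<forall>z\<in>worlds M. (u, z) \<in> acc M \<longrightarrow> (f u, f z) \<in> acc N) \<and>
     (\<forall>p\<in>Props. \<forall>u\<in>worlds M. u \<in> val M p \<longrightarrow> f u \<in> val N p))"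

definition is_inj_hom ::
  "'p set \<Rightarrow> ('w, 'p) pointed \<Rightarrow> ('v, 'p) pointed \<Rightarrow> ('w \<Rightarrow> 'v) \<Rightarrow> bool" where
  "is_inj_hom Props P Q f \<longleftrightarrow> is_hom Props P Q f \<and> inj_on f (worlds (fst P))"

definition is_embedding ::
  "'p set \<Rightarrow> ('w, 'p) pointed \<Rightarrow> ('v, 'p) pointed \<Rightarrow> ('w \<Rightarrow> 'v) \<Rightarrow> bool" where
  "is_embedding Props = (\<lambda>(M, w) (N, v) f.
     f \<in> worlds M \<rightarrow> worlds N \<and> f w = v \<and> inj_on f (worlds M) \<and>
     (\<forall>u\<in>worlds M. \<forall>z\<in>worlds M. (u, z) \<in> acc M \<longleftrightarrow> (f u, f z) \<in> acc N) \<and>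
     (\<forall>p\<in>Props. \<forall>u\<in>worlds M. u \<in> val M p \<longleftrightarrow> f u \<in> val N p))"

definition hom_le :: "'p set \<Rightarrow> ('w, 'p) pointed \<Rightarrow> ('v, 'p) pointed \<Rightarrow> bool" where
  "hom_le Props P Q \<longleftrightarrow> (\<exists>f. is_hom Props P Q f)"

definition inj_hom_le :: "'p set \<Rightarrow> ('w, 'p) pointed \<Rightarrow> ('v, 'p) pointed \<Rightarrow> bool" where
  "inj_hom_le Props P Q \<longleftrightarrow> (\<exists>f. is_inj_hom Props P Q f)"

definition embedding_le :: "'p set \<Rightarrow> ('w, 'p) pointed \<Rightarrow> ('v, 'p) pointed \<Rightarrow> bool" where
  "embedding_le Props P Q \<longleftrightarrow> (\<exists>f. is_embedding Props P Q f)"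

definition wqo_on :: "'a set \<Rightarrow> ('a \<Rightarrow> 'a \<Rightarrow> bool) \<Rightarrow> bool" where
  "wqo_on A r \<longleftrightarrow>
     reflp_on A r \<and> transp_on A r \<and>
     (\<forall>a :: nat \<Rightarrow> 'a. range a \<subseteq> A \<longrightarrow> (\<exists>i j. i < j \<and> r (a i) (a j)))"

definition tree_class :: "'p set \<Rightarrow> ('w, 'p) pointed set \<Rightarrow> bool" where
  "tree_class Props C \<longleftrightarrow> (\<forall>P\<in>C. pointed_model Props P \<and> tree_shaped P)"

text \<open>
  Failure of \<^const>\<open>wqo_on\<close> for these relations is always due to a bad sequence, as they are
  reflexive and transitive.
\<close>

lemma reflp_le:
  "reflp_on A (hom_le Props)" "reflp_on A (inj_hom_le Props)" "reflp_on A (embedding_le Props)"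
  unfolding reflp_on_def hom_le_def inj_hom_le_def embedding_le_def
    is_hom_def is_inj_hom_def is_embedding_def
  by (auto intro!: exI[of _ "\<lambda>x. x"])

lemma is_hom_comp:
  "is_hom Props P Q f \<Longrightarrow> is_hom Props Q S g \<Longrightarrow> is_hom Props P S (g \<circ> f)"
  unfolding is_hom_def by (auto simp: Pi_iff split: prod.splits)

lemma is_inj_hom_comp:
  assumes "is_inj_hom Props P Q f" and "is_inj_hom Props Q S g"
  shows "is_inj_hom Props P S (g \<circ> f)"
proof -
  have "f ` worlds (fst P) \<subseteq> worlds (fst Q)"
    using assms(1) by (auto simp: is_inj_hom_def is_hom_def split: prod.splits)
  then show ?thesis
    using assms unfolding is_inj_hom_def
    by (meson comp_inj_on inj_on_subset is_hom_comp)
qed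

lemma is_embedding_comp:
  "is_embedding Props P Q f \<Longrightarrow> is_embedding Props Q S g \<Longrightarrow> is_embedding Props P S (g \<circ> f)"
  unfolding is_embedding_def by (auto simp: Pi_iff inj_on_def split: prod.splits)

lemma transp_le:
  "transp_on A (hom_le Props)" "transp_on A (inj_hom_le Props)" "transp_on A (embedding_le Props)"
  unfolding transp_on_def hom_le_def inj_hom_le_def embedding_le_def
  by (meson is_hom_comp is_inj_hom_comp is_embedding_comp)+

end

theory Submission
  imports Defs
begin

text \<open>
  Take directed paths \<open>0 \<rightarrow> 1 \<rightarrow> \<dots> \<rightarrow> n\<close>, rooted at \<open>0\<close>, whose only labelled world is the endpoint
  \<open>n\<close>. A homomorphism fixes the root and preserves edges, so it maps the world at distance \<open>i\<close> from
  the root to the world at distance \<open>i\<close>; as it preserves the label, the two endpoints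
  are at the same distance from their roots. Paths of different length are therefore
  incomparable under homomorphisms, hence also under the two stronger notions of map.
\<close>

text \<open>The valuation is a restricted function because \<open>kripke_model\<close> requires it
  to be extensional on \<open>Props\<close>.\<close>

definition marked_path :: "nat \<Rightarrow> (nat, nat) pointed" where
  "marked_path n =
     (\<lparr>worlds = {..n}, acc = {(i, Suc i) | i. i < n}, val = (\<lambda>p\<in>{0}. {n})\<rparr>, 0)"

text \<open>A path from the root is determined by its endpoint \<open>k\<close>, which is also its
  length; tree-shapedness and height are both read off from this.\<close>

lemma dpath_from_marked_path_iff:
  "dpath_from (fst (marked_path n)) 0 xs \<longleftrightarrow> (\<exists>k\<le>n. xs = [0..<Suc k])"
proof
  assume "dpath_from (fst (marked_path n)) 0 xs"
  then have ne: "xs \<noteq> []" and hd: "xs ! 0 = 0" and sub: "set xs \<subseteq> {..n}"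
    and step: "\<And>i. Suc i < length xs \<Longrightarrow> xs ! Suc i = Suc (xs ! i)"
    by (auto simp: dpath_from_def marked_path_def hd_conv_nth successively_conv_nth)
  have nth: "xs ! i = i" if "i < length xs" for i
    using that by (induction i) (simp_all add: hd step)
  have "length xs - 1 \<le> n"
    using ne sub nth[of "length xs - 1"] nth_mem[of "length xs - 1" xs] by auto
  \<comment> \<open>The witness \<open>k\<close> is the last world; as \<open>xs\<close> is
    non-empty, \<open>Suc (length xs - 1)\<close> is \<open>length xs\<close>.\<close>
  moreover have "xs = [0..<Suc (length xs - 1)]"
    using ne nth by (intro nth_equalityI) (auto simp del: upt_Suc)
  ultimately show "\<exists>k\<le>n. xs = [0..<Suc k]" by blast
next
  assume "\<exists>k\<le>n. xs = [0..<Suc k]"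
  then show "dpath_from (fst (marked_path n)) 0 xs"
    by (auto simp: dpath_from_def marked_path_def successively_conv_nth hd_conv_nth
        simp del: upt_Suc)
qed

lemma pointed_model_marked_path: "pointed_model {0} (marked_path n)"
  by (auto simp: pointed_model_def kripke_model_def marked_path_def)

lemma tree_shaped_marked_path: "tree_shaped (marked_path n)"
proof -
  have "\<exists>!xs. dpath_from (fst (marked_path n)) 0 xs \<and> last xs = v" if "v \<le> n" for v
    unfolding dpath_from_marked_path_iff
    using that by (intro ex1I[of _ "[0..<Suc v]"]) auto
  then show ?thesis
    by (simp add: tree_shaped_def marked_path_def)
qed

lemma height_marked_path: "height (marked_path n) = n"
proof -
  have "{dpath_length xs | xs. dpath_from (fst (marked_path n)) 0 xs} = {..n}"
    by (force simp: dpath_from_marked_path_iff dpath_length_def)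
  moreover have "Max {..n} = n"
    by (intro Max_eqI) auto
  ultimately show ?thesis
    by (simp add: height_def marked_path_def)
qed

lemma hom_le_marked_path_imp_eq:
  assumes "hom_le {0} (marked_path m) (marked_path n)"
  shows "m = n"
proof -
  \<comment> \<open>The only edge leaving a world \<open>k\<close> of the target goes to
    \<open>Suc k\<close>, and only \<open>n\<close> is labelled there, so both images are
    forced.\<close>
  from assms obtain f where root: "f 0 = 0" and label: "f m = n"
    and step: "\<And>i. i < m \<Longrightarrow> f (Suc i) = Suc (f i)"
    by (auto simp: hom_le_def is_hom_def marked_path_def)
  have "f i = i" if "i \<le> m" for i
    using that by (induction i) (simp_all add: root step)
  with label show ?thesis by simp
qed

lemma inj_hom_le_imp_hom_le: "inj_hom_le Props P Q \<Longrightarrow> hom_le Props P Q"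
  by (auto simp: inj_hom_le_def hom_le_def is_inj_hom_def)

lemma embedding_le_imp_hom_le: "embedding_le Props P Q \<Longrightarrow> hom_le Props P Q"
  by (auto simp: embedding_le_def hom_le_def is_embedding_def is_hom_def split: prod.splits)

text \<open>Keeping \<open>r\<close> arbitrary below \<open>hom_le\<close> lets one class refute all
  three relations.\<close>

lemma not_wqo_on_marked_paths:
  assumes "\<And>P Q. r P Q \<Longrightarrow> hom_le {0} P Q"
  shows "\<not> wqo_on (range marked_path) r"
proof
  assume "wqo_on (range marked_path) r"
  \<comment> \<open>The bad sequence is \<open>marked_path\<close> itself: a pair
    \<open>i < j\<close> related by \<open>r\<close> would force \<open>i = j\<close>.\<close>
  then obtain i j where "i < j" "r (marked_path i) (marked_path j)"
    unfolding wqo_on_def by blast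
  then show False
    using assms hom_le_marked_path_imp_eq by blast
qed

theorem theorem3p4:
  "\<exists>Props :: nat set. finite Props \<and>
     (\<exists>C :: (nat, nat) pointed set. tree_class Props C \<and> unbounded_height C \<and>
        \<not> wqo_on C (embedding_le Props)) \<and>
     (\<exists>C :: (nat, nat) pointed set. tree_class Props C \<and> unbounded_height C \<and>
        \<not> wqo_on C (inj_hom_le Props)) \<and>
     (\<exists>C :: (nat, nat) pointed set. tree_class Props C \<and> unbounded_height C \<and>
        \<not> wqo_on C (hom_le Props))"
proof -
  have "tree_class {0} (range marked_path)"
    by (auto simp: tree_class_def pointed_model_marked_path tree_shaped_marked_path)
  moreover have "unbounded_height (range marked_path)"
    by (auto simp: unbounded_height_def height_marked_path)
  moreover have "finite {0 :: nat}" by simp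
  ultimately show ?thesis
    using not_wqo_on_marked_paths embedding_le_imp_hom_le inj_hom_le_imp_hom_le by metis
qed

end
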